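(* Let $f:\mathbb{R}^n\to\mathbb{R}$ be convex and twice continuously differentiable with gradient $g=\nabla f$, let $\mu>0$, $\tau>0$, and let $x^*$ be a minimizer of $\phi(x)=f(x)+\mu\|x\|_1$. Suppose that $\nabla^2f$ is Lipschitz continuous, $\nabla^2f(x^* )$ is positive definite, $\tau<1/\|\nabla^2f(x^* )\|$, and that, for each $k\ge0$, $x_{k+1}$ is computed by solving $$F_q(x_k;x_{k+1})=r_k,$$ where $r_k\in\mathbb{R}^n$ is a vector with $\|r_k\|\le\eta_k\|F(x_k)\|$, $\eta_k\ge 0$. Then there is a neighborhood $\mathcal{N}$ of $x^*$ and a value $\bar\eta>0$ such that if $\eta_k\le\bar\eta$ for all $k$ and if $x_0\in\mathcal{N}$, then the sequence $\{x_k\}$ converges Q-linearly to $x^*$. In addition, if $\eta_k\to0$, then the convergence rate of $\{x_k\}$ is Q-superlinear. Finally, if for some $\tilde\eta$, $\eta_k\le\tilde\eta\|F(x_k)\|$ for all $k$, then the convergence rate is Q-quadratic.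
   Context: $P_{[-\mu,\mu]}$ denotes the componentwise projection of a vector in $\mathbb{R}^n$ onto the interval $[-\mu,\mu]$. For $x,y\in\mathbb{R}^n$, $$F(x)=g(x)-P_{[-\mu,\mu]}\big(g(x)-x/\tau\big),$$ $$F_q(x;y)=g(x)+\nabla^2f(x)(y-x)-P_{[-\mu,\mu]}\big(g(x)+\nabla^2f(x)(y-x)-y/\tau\big).$$ $\|\cdot\|$ is the Euclidean norm for vectors and the induced (spectral) norm for matrices. A sequence $x_k\to x^*$ converges Q-linearly if there is $c\in(0,1)$ with $\|x_{k+1}-x^*\|\le c\|x_k-x^*\|$ for all sufficiently large $k$; Q-superlinearly if there are $\varepsilon_k\to0$ with $\|x_{k+1}-x^*\|\le\varepsilon_k\|x_k-x^*\|$; Q-quadratically if there is $C$ with $\|x_{k+1}-x^*\|\le C\|x_k-x^*\|^2$ for all sufficiently large $k$. The superlinear and quadratic assertions are made under the same requirements $\eta_k\le\bar\eta$ for all $k$ and $x_0\in\mathcal{N}$. *)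

theory Defs
  imports "HOL-Analysis.Analysis"
begin

text \<open>
  The Hessian of a function on \<open>real^'n\<close> is represented as a bounded linear operator
  (type \<open>(real^'n) \<Rightarrow>\<^sub>L (real^'n)\<close>), because \<^const>\<open>norm\<close> and \<^const>\<open>dist\<close> on that type are the
  induced spectral norm and its metric; on the matrix type \<open>real^'n^'n\<close> they would be Frobenius.
\<close>

definition l1_norm :: "real^'n \<Rightarrow> real" where
  "l1_norm x = (\<Sum>i\<in>UNIV. \<bar>x $ i\<bar>)"

definition l1_objective :: "(real^'n \<Rightarrow> real) \<Rightarrow> real \<Rightarrow> real^'n \<Rightarrow> real" where
  "l1_objective f \<mu> x = f x + \<mu> * l1_norm x"

definition interval_proj :: "real \<Rightarrow> real^'n \<Rightarrow> real^'n" where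
  "interval_proj \<mu> v = (\<chi> i. closest_point {-\<mu>..\<mu>} (v $ i))"

lemma interval_proj_nth:
  assumes "\<mu> \<ge> 0"
  shows "interval_proj \<mu> v $ i = max (-\<mu>) (min \<mu> (v $ i))"
proof -
  have "max (-\<mu>) (min \<mu> (v $ i)) = closest_point {-\<mu>..\<mu>} (v $ i)"
  proof (rule closest_point_unique)
    show "max (-\<mu>) (min \<mu> (v $ i)) \<in> {-\<mu>..\<mu>}"
      using assms by auto
    show "\<forall>z\<in>{-\<mu>..\<mu>}. dist (v $ i) (max (-\<mu>) (min \<mu> (v $ i))) \<le> dist (v $ i) z"
      using assms by (auto simp: dist_real_def max_def min_def)
  qed auto
  then show ?thesis by (simp add: interval_proj_def)
qed

definition F_res :: "(real^'n \<Rightarrow> real^'n) \<Rightarrow> real \<Rightarrow> real \<Rightarrow> real^'n \<Rightarrow> real^'n" where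
  "F_res g \<mu> \<tau> x = g x - interval_proj \<mu> (g x - x /\<^sub>R \<tau>)"

definition Fq_res ::
  "(real^'n \<Rightarrow> real^'n) \<Rightarrow> (real^'n \<Rightarrow> ((real^'n) \<Rightarrow>\<^sub>L (real^'n))) \<Rightarrow> real \<Rightarrow> real \<Rightarrow>
    real^'n \<Rightarrow> real^'n \<Rightarrow> real^'n" where
  "Fq_res g H \<mu> \<tau> x y =
    g x + blinfun_apply (H x) (y - x)
      - interval_proj \<mu> (g x + blinfun_apply (H x) (y - x) - y /\<^sub>R \<tau>)"

definition pos_definite :: "((real^'n) \<Rightarrow>\<^sub>L (real^'n)) \<Rightarrow> bool" where
  "pos_definite A \<longleftrightarrow> (\<forall>v. v \<noteq> 0 \<longrightarrow> v \<bullet> blinfun_apply A v > 0)"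

definition Q_linear :: "(nat \<Rightarrow> 'a::real_normed_vector) \<Rightarrow> 'a \<Rightarrow> bool" where
  "Q_linear x a \<longleftrightarrow> x \<longlonglongrightarrow> a \<and>
    (\<exists>c. 0 < c \<and> c < 1 \<and>
      (\<forall>\<^sub>F k in sequentially. norm (x (Suc k) - a) \<le> c * norm (x k - a)))"

definition Q_superlinear :: "(nat \<Rightarrow> 'a::real_normed_vector) \<Rightarrow> 'a \<Rightarrow> bool" where
  "Q_superlinear x a \<longleftrightarrow> x \<longlonglongrightarrow> a \<and>
    (\<exists>\<epsilon>. \<epsilon> \<longlonglongrightarrow> (0::real) \<and> (\<forall>k. norm (x (Suc k) - a) \<le> \<epsilon> k * norm (x k - a)))"

definition Q_quadratic :: "(nat \<Rightarrow> 'a::real_normed_vector) \<Rightarrow> 'a \<Rightarrow> bool" where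
  "Q_quadratic x a \<longleftrightarrow> x \<longlonglongrightarrow> a \<and>
    (\<exists>C. \<forall>\<^sub>F k in sequentially. norm (x (Suc k) - a) \<le> C * (norm (x k - a))\<^sup>2)"

end

theory Submission
  imports Defs
begin

text \<open>
  The equation for the new iterate is treated as a perturbation of the equation \<open>F_q(x_k; y) = 0\<close>,
  and the whole theorem rests on one estimate: near \<open>x\<^sup>*\<close> the map \<open>y \<mapsto> F_q(x; y)\<close> is inversely
  Lipschitz, with a constant that does not depend on \<open>x\<close>.

  To see this, let \<open>w = y - z\<close>, let \<open>A\<close> be the Hessian at \<open>x\<close>, let \<open>p\<close> be the difference of the
  two projections in \<open>F_q(x; y)\<close> and \<open>F_q(x; z)\<close>, and let \<open>q = A w - p\<close> be the difference of the
  residuals. The arguments of the projections differ by \<open>A w - w/\<tau>\<close>, so the projections' residuals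
  differ by \<open>A w - w/\<tau> - p = q - w/\<tau>\<close>. The projection onto a box is firmly nonexpansive, hence
  \<open>(A w - q) \<bullet> (q - w/\<tau>) \<ge> 0\<close>. Expanding gives
  \<open>w \<bullet> A w \<le> \<tau> (q \<bullet> A w) + w \<bullet> q - \<tau> \<parallel>q\<parallel>\<^sup>2 \<le> (1 + \<tau>\<parallel>A\<parallel>) \<parallel>q\<parallel> \<parallel>w\<parallel>\<close>,
  and positive definiteness of \<open>A\<close> bounds the left side below by a multiple of \<open>\<parallel>w\<parallel>\<^sup>2\<close>
  (\<open>Fq_res_inverse_Lipschitz\<close>).

  Apply this with \<open>y = x\<^sub>k\<^sub>+\<^sub>1\<close> and \<open>z = x\<^sup>*\<close>. The first residual is \<open>r\<^sub>k\<close>. The second is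
  quadratically small in \<open>\<delta>\<^sub>k = \<parallel>x\<^sub>k - x\<^sup>*\<parallel>\<close>: optimality means \<open>F(x\<^sup>*) = 0\<close>
  (\<open>F_res_minimizer\<close>), and \<open>F_q(x\<^sub>k; x\<^sup>*)\<close> differs from \<open>F(x\<^sup>*)\<close> only by the linearization error of
  the gradient, which is \<open>O(\<delta>\<^sub>k\<^sup>2)\<close> because the Hessian is Lipschitz. Moreover
  \<open>\<parallel>F(x\<^sub>k)\<parallel> = O(\<delta>\<^sub>k)\<close>. Together,
  \<open>\<delta>\<^sub>k\<^sub>+\<^sub>1 \<le> (\<alpha> \<eta>\<^sub>k + \<beta> \<delta>\<^sub>k) \<delta>\<^sub>k\<close> as long as \<open>x\<^sub>k\<close> is close to \<open>x\<^sup>*\<close>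
  (\<open>inexact_Newton_step\<close>), and all three convergence rates can be read off this recursion.
\<close>

section \<open>The projection onto a box\<close>

lemma interval_proj_firmly_nonexpansive:
  fixes a b :: "real^'n"
  assumes "\<mu> \<ge> 0"
  shows "0 \<le> (interval_proj \<mu> a - interval_proj \<mu> b) \<bullet>
              ((a - interval_proj \<mu> a) - (b - interval_proj \<mu> b))"
proof -
  define P where "P = (\<lambda>t::real. max (-\<mu>) (min \<mu> t))"
  have "0 \<le> (P s - P t) * ((s - P s) - (t - P t))" for s t :: real
  \<comment> \<open>both \<open>P\<close> and \<open>id - P\<close> are nondecreasing\<close>
  proof (cases "s \<le> t")
    case True
    then have "P s - P t \<le> 0" "(s - P s) - (t - P t) \<le> 0"
      using assms unfolding P_def by linarith+
    then show ?thesis by (rule mult_nonpos_nonpos)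
  next
    case False
    then have "P s - P t \<ge> 0" "(s - P s) - (t - P t) \<ge> 0"
      using assms unfolding P_def by linarith+
    then show ?thesis by (rule mult_nonneg_nonneg)
  qed
  then show ?thesis
    unfolding inner_vec_def
    by (intro sum_nonneg) (simp add: interval_proj_nth[OF assms] P_def)
qed

lemma interval_proj_nonexpansive:
  fixes a b :: "real^'n"
  assumes "\<mu> \<ge> 0"
  shows "norm (interval_proj \<mu> a - interval_proj \<mu> b) \<le> norm (a - b)"
proof -
  define p where "p = interval_proj \<mu> a - interval_proj \<mu> b"
  have "0 \<le> p \<bullet> ((a - b) - p)"
    using interval_proj_firmly_nonexpansive[OF assms, of a b] by (simp add: p_def algebra_simps)
  then have "norm p * norm p \<le> p \<bullet> (a - b)"
    by (simp add: inner_diff_right norm_eq_sqrt_inner)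
  also have "\<dots> \<le> norm p * norm (a - b)" by (rule norm_cauchy_schwarz)
  finally show ?thesis unfolding p_def[symmetric]
    by (cases "p = 0") auto
qed

text \<open>The gradient value enters the residual twice, directly and through the projection; the point
  enters only through the projection, scaled by \<open>1/\<tau>\<close>. Both \<open>F\<close> and \<open>F_q\<close> are of this form, so one
  estimate serves to compare any two of their values.\<close>

lemma prox_residual_perturb:
  fixes u v x y :: "real^'n"
  assumes "\<mu> \<ge> 0" "\<tau> > 0"
  shows "norm ((u - interval_proj \<mu> (u - x /\<^sub>R \<tau>)) - (v - interval_proj \<mu> (v - y /\<^sub>R \<tau>)))
         \<le> 2 * norm (u - v) + norm (x - y) / \<tau>"
proof -
  have "norm (interval_proj \<mu> (u - x /\<^sub>R \<tau>) - interval_proj \<mu> (v - y /\<^sub>R \<tau>))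
        \<le> norm ((u - x /\<^sub>R \<tau>) - (v - y /\<^sub>R \<tau>))"
    by (rule interval_proj_nonexpansive[OF assms(1)])
  also have "(u - x /\<^sub>R \<tau>) - (v - y /\<^sub>R \<tau>) = (u - v) - (x - y) /\<^sub>R \<tau>"
    by (simp add: algebra_simps)
  also have "norm \<dots> \<le> norm (u - v) + norm (x - y) / \<tau>"
    using norm_triangle_ineq4[of "u - v" "(x - y) /\<^sub>R \<tau>"] assms(2)
    by (simp add: divide_inverse mult.commute)
  finally have P: "norm (interval_proj \<mu> (u - x /\<^sub>R \<tau>) - interval_proj \<mu> (v - y /\<^sub>R \<tau>))
        \<le> norm (u - v) + norm (x - y) / \<tau>" .
  have "(u - interval_proj \<mu> (u - x /\<^sub>R \<tau>)) - (v - interval_proj \<mu> (v - y /\<^sub>R \<tau>))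
        = (u - v) - (interval_proj \<mu> (u - x /\<^sub>R \<tau>) - interval_proj \<mu> (v - y /\<^sub>R \<tau>))"
    by simp
  also have "norm \<dots> \<le> norm (u - v)
        + norm (interval_proj \<mu> (u - x /\<^sub>R \<tau>) - interval_proj \<mu> (v - y /\<^sub>R \<tau>))"
    by (rule norm_triangle_ineq4)
  also have "\<dots> \<le> 2 * norm (u - v) + norm (x - y) / \<tau>"
    using P by simp
  finally show ?thesis .
qed

section \<open>Optimality\<close>

lemma l1_norm_convex_comb:
  fixes x d :: "real^'n"
  assumes "0 \<le> t" "t \<le> 1"
  shows "l1_norm (x + t *\<^sub>R d) \<le> (1 - t) * l1_norm x + t * l1_norm (x + d)"
proof -
  have "\<bar>(x + t *\<^sub>R d) $ i\<bar> \<le> (1 - t) * \<bar>x $ i\<bar> + t * \<bar>(x + d) $ i\<bar>" for i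
  proof -
    have "(x + t *\<^sub>R d) $ i = (1 - t) * x $ i + t * (x + d) $ i" by (simp add: algebra_simps)
    also have "\<bar>\<dots>\<bar> \<le> \<bar>(1 - t) * x $ i\<bar> + \<bar>t * (x + d) $ i\<bar>" by (rule abs_triangle_ineq)
    finally show ?thesis using assms by (simp add: abs_mult)
  qed
  then have "l1_norm (x + t *\<^sub>R d)
      \<le> (\<Sum>i\<in>UNIV. (1 - t) * \<bar>x $ i\<bar> + t * \<bar>(x + d) $ i\<bar>)"
    unfolding l1_norm_def by (rule sum_mono)
  then show ?thesis
    by (simp add: l1_norm_def sum.distrib sum_distrib_left)
qed

text \<open>First-order optimality. Along the segment from \<open>x\<close> to \<open>x + d\<close> the norm term grows at most
  linearly, so the difference quotients of \<open>f\<close> in direction \<open>d\<close> are bounded below.\<close>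

lemma l1_objective_minimizer_variational:
  fixes x :: "real^'n"
  assumes min: "is_arg_min (l1_objective f \<mu>) (\<lambda>_. True) x"
    and grad: "GDERIV f x :> v" and "\<mu> \<ge> 0"
  shows "0 \<le> v \<bullet> d + \<mu> * (l1_norm (x + d) - l1_norm x)"
proof -
  define D where "D = l1_norm (x + d) - l1_norm x"
  have le: "l1_objective f \<mu> x \<le> l1_objective f \<mu> y" for y
    using min by (auto simp: is_arg_min_def not_less)
  have "((\<lambda>t. f (x + t *\<^sub>R d)) has_derivative (\<lambda>t. (t *\<^sub>R d) \<bullet> v)) (at 0)"
  proof (rule has_derivative_compose[where f = "\<lambda>t::real. x + t *\<^sub>R d"
        and g = f and g' = "\<lambda>h. h \<bullet> v"])
    show "((\<lambda>t::real. x + t *\<^sub>R d) has_derivative (\<lambda>t. t *\<^sub>R d)) (at 0)"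
      by (auto intro!: derivative_eq_intros)
    show "(f has_derivative (\<lambda>h. h \<bullet> v)) (at (x + 0 *\<^sub>R d))"
      using grad by (simp add: gderiv_def)
  qed
  then have "((\<lambda>t. f (x + t *\<^sub>R d)) has_field_derivative (v \<bullet> d)) (at 0)"
    by (rule has_derivative_imp_has_field_derivative) (simp add: inner_commute)
  then have "((\<lambda>t. (f (x + t *\<^sub>R d) - f x) / t) \<longlongrightarrow> v \<bullet> d) (at 0)"
    by (simp add: has_field_derivative_iff)
  then have lim: "((\<lambda>t. (f (x + t *\<^sub>R d) - f x) / t) \<longlongrightarrow> v \<bullet> d) (at_right 0)"
    by (rule tendsto_within_subset) auto
  have "- (\<mu> * D) \<le> (f (x + t *\<^sub>R d) - f x) / t" if "0 < t" "t < 1" for t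
  proof -
    have "l1_norm (x + t *\<^sub>R d) \<le> l1_norm x + t * D"
      using l1_norm_convex_comb[of t x d] that by (simp add: D_def algebra_simps)
    then have "\<mu> * l1_norm (x + t *\<^sub>R d) \<le> \<mu> * (l1_norm x + t * D)"
      using \<open>\<mu> \<ge> 0\<close> by (rule mult_left_mono)
    then have "- (\<mu> * D) * t \<le> f (x + t *\<^sub>R d) - f x"
      using le[of "x + t *\<^sub>R d"] by (simp add: l1_objective_def algebra_simps)
    then show ?thesis using that by (simp add: pos_le_divide_eq)
  qed
  then have "\<forall>\<^sub>F t in at_right 0. - (\<mu> * D) \<le> (f (x + t *\<^sub>R d) - f x) / t"
    unfolding eventually_at_right_field by (intro exI[of _ 1]) auto
  then have "- (\<mu> * D) \<le> v \<bullet> d"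
    using lim by (intro tendsto_lowerbound[of _ _ "at_right (0::real)"]) auto
  then show ?thesis by (simp add: D_def)
qed

text \<open>Testing the variational inequality along the coordinate axes shows that each gradient
  coordinate is \<open>-\<mu>\<close>, \<open>\<mu>\<close> or in \<open>[-\<mu>, \<mu>]\<close> according to the sign of the coordinate of the
  minimizer. In each case moving by \<open>-x\<^sub>i/\<tau>\<close> and projecting leads back to that gradient coordinate.\<close>

lemma F_res_minimizer:
  fixes x :: "real^'n"
  assumes min: "is_arg_min (l1_objective f \<mu>) (\<lambda>_. True) x"
    and grad: "GDERIV f x :> g x" and mu: "\<mu> \<ge> 0" and tau: "\<tau> > 0"
  shows "F_res g \<mu> \<tau> x = 0"
proof -
  have var: "0 \<le> g x $ i * s + \<mu> * (\<bar>x $ i + s\<bar> - \<bar>x $ i\<bar>)" for i s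
  proof -
    have "l1_norm (x + axis i s) - l1_norm x = (\<Sum>j\<in>UNIV. \<bar>(x + axis i s) $ j\<bar> - \<bar>x $ j\<bar>)"
      by (simp add: l1_norm_def sum_subtractf)
    also have "\<dots> = (\<Sum>j\<in>UNIV. if j = i then \<bar>x $ i + s\<bar> - \<bar>x $ i\<bar> else 0)"
      by (intro sum.cong) (auto simp: axis_def)
    also have "\<dots> = \<bar>x $ i + s\<bar> - \<bar>x $ i\<bar>" by simp
    finally show ?thesis
      using l1_objective_minimizer_variational[OF min grad mu, of "axis i s"]
      by (simp add: inner_axis)
  qed
  have "g x $ i = max (-\<mu>) (min \<mu> (g x $ i - x $ i / \<tau>))" for i
  proof -
    consider "x $ i > 0" | "x $ i < 0" | "x $ i = 0" by linarith
    then show ?thesis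
    proof cases
      case 1
      have "0 \<le> (- \<mu> - g x $ i) * x $ i" "0 \<le> (\<mu> + g x $ i) * x $ i"
        using var[of i "- x $ i"] var[of i "x $ i"] 1 by (auto simp: algebra_simps)
      then have "g x $ i = -\<mu>" using 1 by (auto simp: zero_le_mult_iff)
      moreover have "x $ i / \<tau> > 0" using 1 tau by simp
      ultimately show ?thesis using mu by linarith
    next
      case 2
      have "0 \<le> (\<mu> - g x $ i) * x $ i" "0 \<le> (g x $ i - \<mu>) * x $ i"
        using var[of i "- x $ i"] var[of i "x $ i"] 2 by (auto simp: algebra_simps)
      then have "g x $ i = \<mu>" using 2 by (auto simp: zero_le_mult_iff)
      moreover have "x $ i / \<tau> < 0" using 2 tau by (simp add: divide_neg_pos)
      ultimately show ?thesis using mu by linarith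
    next
      case 3
      then show ?thesis using var[of i 1] var[of i "-1"] by (auto simp: max_def min_def)
    qed
  qed
  then show ?thesis
    by (simp add: F_res_def vec_eq_iff interval_proj_nth[OF mu] divide_inverse mult.commute)
qed

section \<open>Coercivity of the Hessian\<close>

lemma pos_definite_coercive:
  fixes A :: "(real^'n) \<Rightarrow>\<^sub>L (real^'n)"
  assumes "pos_definite A"
  obtains \<gamma> where "\<gamma> > 0" "\<And>v. \<gamma> * (norm v)\<^sup>2 \<le> v \<bullet> A v"
proof -
  have "continuous_on (sphere 0 1) (\<lambda>v. v \<bullet> A v)"
    by (intro continuous_intros)
  then obtain w where w: "w \<in> sphere 0 1" "\<And>v. v \<in> sphere 0 1 \<Longrightarrow> w \<bullet> A w \<le> v \<bullet> A v"
    using continuous_attains_inf[of "sphere (0::real^'n) 1" "\<lambda>v. v \<bullet> A v"] by auto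
  show thesis
  proof
    show "w \<bullet> A w > 0"
    proof -
      have "w \<noteq> 0" using w(1) by auto
      then show ?thesis using assms unfolding pos_definite_def by blast
    qed
    show "w \<bullet> A w * (norm v)\<^sup>2 \<le> v \<bullet> A v" for v
    proof (cases "v = 0")
      case False
      then have "w \<bullet> A w \<le> (v /\<^sub>R norm v) \<bullet> A (v /\<^sub>R norm v)"
        by (intro w(2)) simp
      also have "\<dots> = v \<bullet> A v / (norm v)\<^sup>2"
        by (simp add: blinfun.scaleR_right power2_eq_square divide_simps)
      finally show ?thesis using False by (simp add: pos_le_divide_eq)
    qed auto
  qed
qed

lemma coercive_perturb:
  fixes A B :: "(real^'n) \<Rightarrow>\<^sub>L (real^'n)"
  assumes "\<And>v. \<gamma> * (norm v)\<^sup>2 \<le> v \<bullet> A v"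
  shows "(\<gamma> - norm (B - A)) * (norm v)\<^sup>2 \<le> v \<bullet> B v"
proof -
  have "- (v \<bullet> (B - A) v) \<le> norm v * norm ((B - A) v)"
    using norm_cauchy_schwarz[of v "- (B - A) v"] by simp
  also have "\<dots> \<le> norm v * (norm (B - A) * norm v)"
    by (intro mult_left_mono norm_blinfun) auto
  finally have "- (v \<bullet> (B - A) v) \<le> norm (B - A) * (norm v)\<^sup>2"
    by (simp add: power2_eq_square mult_ac)
  moreover have "v \<bullet> B v = v \<bullet> A v + v \<bullet> (B - A) v"
    by (simp add: blinfun.diff_left inner_diff_right)
  ultimately show ?thesis
    using assms[of v] by (simp add: algebra_simps)
qed

section \<open>The inexact Newton step\<close>

text \<open>Firm nonexpansiveness of the projection turns coercivity of the linearized gradient into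
  coercivity of the residual map.\<close>

lemma Fq_res_inverse_Lipschitz:
  fixes y z :: "real^'n" and H :: "real^'n \<Rightarrow> (real^'n) \<Rightarrow>\<^sub>L (real^'n)"
  assumes mu: "\<mu> \<ge> 0" and tau: "\<tau> > 0"
    and coercive: "\<And>v. \<gamma> * (norm v)\<^sup>2 \<le> v \<bullet> H x v"
  shows "\<gamma> * norm (y - z)
         \<le> (1 + \<tau> * norm (H x)) * norm (Fq_res g H \<mu> \<tau> x y - Fq_res g H \<mu> \<tau> x z)"
proof -
  define w where "w = y - z"
  define q where "q = Fq_res g H \<mu> \<tau> x y - Fq_res g H \<mu> \<tau> x z"
  define a where "a = g x + H x (y - x) - y /\<^sub>R \<tau>"
  define b where "b = g x + H x (z - x) - z /\<^sub>R \<tau>"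
  define p where "p = interval_proj \<mu> a - interval_proj \<mu> b"
  have p: "p = H x w - q"
    by (simp add: p_def a_def b_def q_def w_def Fq_res_def blinfun.diff_right algebra_simps)
  have ab: "a - b = H x w - w /\<^sub>R \<tau>"
    by (simp add: a_def b_def w_def blinfun.diff_right algebra_simps)
  have "0 \<le> p \<bullet> ((a - b) - p)"
    using interval_proj_firmly_nonexpansive[OF mu, of a b] by (simp add: p_def algebra_simps)
  also have "(a - b) - p = q - w /\<^sub>R \<tau>"
    by (simp add: p ab)
  finally have "0 \<le> \<tau> * ((H x w - q) \<bullet> (q - w /\<^sub>R \<tau>))"
    using tau by (simp add: p)
  also have "\<dots> = \<tau> * (q \<bullet> H x w) + q \<bullet> w - \<tau> * (q \<bullet> q) - w \<bullet> H x w"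
    using tau by (simp add: inner_diff_left inner_diff_right inner_commute field_simps)
  finally have "w \<bullet> H x w \<le> \<tau> * (q \<bullet> H x w) + q \<bullet> w - \<tau> * (q \<bullet> q)"
    by simp
  also have "\<dots> \<le> \<tau> * (q \<bullet> H x w) + q \<bullet> w"
    using tau by simp
  also have "\<dots> \<le> \<tau> * (norm q * (norm (H x) * norm w)) + norm q * norm w"
  proof (intro add_mono mult_left_mono)
    have "q \<bullet> H x w \<le> norm q * norm (H x w)" by (rule norm_cauchy_schwarz)
    also have "\<dots> \<le> norm q * (norm (H x) * norm w)"
      by (intro mult_left_mono norm_blinfun) auto
    finally show "q \<bullet> H x w \<le> norm q * (norm (H x) * norm w)" .
  qed (use tau norm_cauchy_schwarz in auto)
  finally have "(\<gamma> * norm w) * norm w \<le> ((1 + \<tau> * norm (H x)) * norm q) * norm w"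
    using coercive[of w] by (simp add: power2_eq_square algebra_simps)
  then have "\<gamma> * norm w \<le> (1 + \<tau> * norm (H x)) * norm q"
    using tau by (cases "w = 0") auto
  then show ?thesis by (simp add: w_def q_def)
qed

text \<open>The constant is \<open>L\<close> rather than the \<open>L/2\<close> of Taylor's formula because the proof is the mean
  value inequality for \<open>g - H x\<close> on the segment, whose derivative is bounded by its worst value
  \<open>L \<parallel>y - x\<parallel>\<close> there.\<close>

lemma gradient_linearization_error:
  fixes g :: "'a::real_normed_vector \<Rightarrow> 'b::real_normed_vector"
    and H :: "'a \<Rightarrow> 'a \<Rightarrow>\<^sub>L 'b"
  assumes der: "\<And>x. (g has_derivative H x) (at x)"
    and lip: "L-lipschitz_on UNIV H"
  shows "norm (g y - g x - H x (y - x)) \<le> L * (norm (y - x))\<^sup>2"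
proof -
  have "norm (g y - g x - H x (y - x)) \<le> norm (y - x) * (L * norm (y - x))"
  proof (rule differentiable_bound_linearization[where S = "closed_segment x y"
        and f' = "\<lambda>x. H x"])
    show "onorm (blinfun_apply (H z) - blinfun_apply (H x)) \<le> L * norm (y - x)"
      if "z \<in> closed_segment x y" for z
    proof -
      have "onorm (blinfun_apply (H z) - blinfun_apply (H x)) = norm (H z - H x)"
        by (simp only: norm_blinfun.rep_eq minus_blinfun.rep_eq fun_diff_def)
      also have "\<dots> \<le> L * norm (z - x)"
        using lipschitz_onD[OF lip, of z x] by (simp add: dist_norm)
      also have "\<dots> \<le> L * norm (y - x)"
        using segment_bound1[OF that] lipschitz_on_nonneg[OF lip] by (rule mult_left_mono)
      finally show ?thesis .
    qed
    show "x + t *\<^sub>R (y - x) \<in> closed_segment x y" if "t \<in> {0..1}" for t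
      using that unfolding in_segment by (auto intro!: exI[of _ t] simp: algebra_simps)
  qed (auto intro: has_derivative_at_withinI der)
  then show ?thesis by (simp add: power2_eq_square mult_ac)
qed

lemma F_res_bound_near_root:
  fixes x a :: "real^'n" and H :: "real^'n \<Rightarrow> (real^'n) \<Rightarrow>\<^sub>L (real^'n)"
  assumes der: "\<And>x. (g has_derivative H x) (at x)" and lip: "L-lipschitz_on UNIV H"
    and mu: "\<mu> \<ge> 0" and tau: "\<tau> > 0" and root: "F_res g \<mu> \<tau> a = 0"
  shows "norm (F_res g \<mu> \<tau> x) \<le> (2 * (norm (H x) + L * norm (x - a)) + 1 / \<tau>) * norm (x - a)"
proof -
  have "g x - g a = H x (x - a) - (g a - g x - H x (a - x))"
    by (simp add: blinfun.diff_right)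
  then have "norm (g x - g a) \<le> norm (H x (x - a)) + norm (g a - g x - H x (a - x))"
    by (metis norm_triangle_ineq4)
  also have "\<dots> \<le> norm (H x) * norm (x - a) + L * (norm (a - x))\<^sup>2"
    by (intro add_mono norm_blinfun gradient_linearization_error[OF der lip])
  finally have "norm (g x - g a) \<le> (norm (H x) + L * norm (x - a)) * norm (x - a)"
    by (simp add: norm_minus_commute power2_eq_square algebra_simps)
  moreover have "norm (F_res g \<mu> \<tau> x) \<le> 2 * norm (g x - g a) + norm (x - a) / \<tau>"
    using prox_residual_perturb[OF mu tau, of "g x" x "g a" a] root by (simp add: F_res_def)
  ultimately show ?thesis by (simp add: algebra_simps)
qed

lemma Fq_res_at_root:
  fixes x a :: "real^'n" and H :: "real^'n \<Rightarrow> (real^'n) \<Rightarrow>\<^sub>L (real^'n)"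
  assumes der: "\<And>x. (g has_derivative H x) (at x)" and lip: "L-lipschitz_on UNIV H"
    and mu: "\<mu> \<ge> 0" and tau: "\<tau> > 0" and root: "F_res g \<mu> \<tau> a = 0"
  shows "norm (Fq_res g H \<mu> \<tau> x a) \<le> 2 * L * (norm (x - a))\<^sup>2"
proof -
  have "norm (Fq_res g H \<mu> \<tau> x a) = norm (Fq_res g H \<mu> \<tau> x a - F_res g \<mu> \<tau> a)"
    by (simp add: root)
  also have "\<dots> \<le> 2 * norm (g x + H x (a - x) - g a)"
    using prox_residual_perturb[OF mu tau, of "g x + H x (a - x)" a "g a" a]
    by (simp add: F_res_def Fq_res_def)
  also have "norm (g x + H x (a - x) - g a) = norm (g a - g x - H x (a - x))"
    by (metis norm_minus_commute diff_diff_add)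
  also have "2 * \<dots> \<le> 2 * (L * (norm (a - x))\<^sup>2)"
    by (intro mult_left_mono gradient_linearization_error[OF der lip]) auto
  finally show ?thesis by (simp add: norm_minus_commute)
qed

text \<open>The constants are uniform on a ball around \<open>a\<close> on which the Hessian keeps half of its
  coercivity at \<open>a\<close>.\<close>

lemma inexact_Newton_step:
  fixes a :: "real^'n" and H :: "real^'n \<Rightarrow> (real^'n) \<Rightarrow>\<^sub>L (real^'n)"
  assumes der: "\<And>x. (g has_derivative H x) (at x)" and lip: "L-lipschitz_on UNIV H"
    and mu: "\<mu> \<ge> 0" and tau: "\<tau> > 0" and root: "F_res g \<mu> \<tau> a = 0"
    and pos: "pos_definite (H a)"
  obtains \<rho> M \<alpha> \<beta> where "\<rho> > 0" "M > 0" "\<alpha> > 0" "\<beta> \<ge> 0"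
    and "\<And>x. norm (x - a) < \<rho> \<Longrightarrow> norm (F_res g \<mu> \<tau> x) \<le> M * norm (x - a)"
    and "\<And>x y e. norm (x - a) < \<rho> \<Longrightarrow> e \<ge> 0
           \<Longrightarrow> norm (Fq_res g H \<mu> \<tau> x y) \<le> e * norm (F_res g \<mu> \<tau> x)
           \<Longrightarrow> norm (y - a) \<le> (\<alpha> * e + \<beta> * norm (x - a)) * norm (x - a)"
proof -
  obtain \<gamma> where \<gamma>: "\<gamma> > 0" "\<And>v. \<gamma> * (norm v)\<^sup>2 \<le> v \<bullet> H a v"
    using pos_definite_coercive[OF pos] by blast
  have L: "L \<ge> 0" using lip by (rule lipschitz_on_nonneg)
  define \<rho> where "\<rho> = min 1 (\<gamma> / (2 * (L + 1)))"
  define B where "B = norm (H a) + \<gamma> / 2"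
  define M where "M = 2 * (B + L) + 1 / \<tau>"
  define K where "K = (1 + \<tau> * B) / (\<gamma> / 2)"
  have B: "B > 0" using \<gamma>(1) by (simp add: B_def add_nonneg_pos)
  have M: "M > 0" using B L tau by (simp add: M_def add_nonneg_pos)
  have K: "K > 0" using B \<gamma>(1) tau by (simp add: K_def add_pos_pos)
  have near: "norm (H x - H a) \<le> \<gamma> / 2" if "norm (x - a) < \<rho>" for x
  proof -
    have "norm (H x - H a) \<le> L * norm (x - a)"
      using lipschitz_onD[OF lip, of x a] by (simp add: dist_norm)
    also have "\<dots> \<le> (L + 1) * (\<gamma> / (2 * (L + 1)))"
      using that L by (intro mult_mono) (auto simp: \<rho>_def)
    also have "\<dots> = \<gamma> / 2" using L by (simp add: field_simps)
    finally show ?thesis .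
  qed
  have HB: "norm (H x) \<le> B" if "norm (x - a) < \<rho>" for x
    using near[OF that] norm_triangle_sub[of "H x" "H a"] by (simp add: B_def)
  have FM: "norm (F_res g \<mu> \<tau> x) \<le> M * norm (x - a)" if x: "norm (x - a) < \<rho>" for x
  proof -
    have "L * norm (x - a) \<le> L * 1"
      using x L by (intro mult_left_mono) (auto simp: \<rho>_def)
    then have "2 * (norm (H x) + L * norm (x - a)) + 1 / \<tau> \<le> M"
      using HB[OF x] by (simp add: M_def)
    then have "(2 * (norm (H x) + L * norm (x - a)) + 1 / \<tau>) * norm (x - a) \<le> M * norm (x - a)"
      by (rule mult_right_mono) simp
    then show ?thesis
      using F_res_bound_near_root[OF der lip mu tau root, of x] by linarith
  qed
  show thesis
  proof (rule that[of \<rho> M "K * M" "2 * K * L"])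
    fix x y :: "real^'n" and e :: real
    assume x: "norm (x - a) < \<rho>" and e: "e \<ge> 0"
      and res: "norm (Fq_res g H \<mu> \<tau> x y) \<le> e * norm (F_res g \<mu> \<tau> x)"
    have coercive: "\<gamma> / 2 * (norm v)\<^sup>2 \<le> v \<bullet> H x v" for v
    proof -
      have "\<gamma> / 2 * (norm v)\<^sup>2 \<le> (\<gamma> - norm (H x - H a)) * (norm v)\<^sup>2"
        using near[OF x] by (intro mult_right_mono) auto
      also have "\<dots> \<le> v \<bullet> H x v" by (rule coercive_perturb[OF \<gamma>(2)])
      finally show ?thesis .
    qed
    have "norm (Fq_res g H \<mu> \<tau> x y - Fq_res g H \<mu> \<tau> x a)
          \<le> norm (Fq_res g H \<mu> \<tau> x y) + norm (Fq_res g H \<mu> \<tau> x a)"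
      by (rule norm_triangle_ineq4)
    also have "\<dots> \<le> e * (M * norm (x - a)) + 2 * L * (norm (x - a))\<^sup>2"
    proof (rule add_mono)
      show "norm (Fq_res g H \<mu> \<tau> x y) \<le> e * (M * norm (x - a))"
        using res mult_left_mono[OF FM[OF x] e] by linarith
    qed (rule Fq_res_at_root[OF der lip mu tau root])
    finally have q: "norm (Fq_res g H \<mu> \<tau> x y - Fq_res g H \<mu> \<tau> x a)
          \<le> e * (M * norm (x - a)) + 2 * L * (norm (x - a))\<^sup>2" .
    have "\<gamma> / 2 * norm (y - a)
          \<le> (1 + \<tau> * norm (H x)) * norm (Fq_res g H \<mu> \<tau> x y - Fq_res g H \<mu> \<tau> x a)"
      by (rule Fq_res_inverse_Lipschitz[where H = H, OF mu tau coercive])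
    also have "\<dots> \<le> (1 + \<tau> * B) * (e * (M * norm (x - a)) + 2 * L * (norm (x - a))\<^sup>2)"
      using HB[OF x] q tau B by (intro mult_mono) auto
    finally have "norm (y - a) \<le> K * (e * (M * norm (x - a)) + 2 * L * (norm (x - a))\<^sup>2)"
      using \<gamma>(1) by (simp add: K_def field_simps)
    then show "norm (y - a) \<le> (K * M * e + 2 * K * L * norm (x - a)) * norm (x - a)"
      by (simp add: power2_eq_square algebra_simps)
  qed (use \<gamma>(1) L M K FM in \<open>auto simp: \<rho>_def\<close>)
qed

section \<open>Convergence rates from the error recursion\<close>

text \<open>The smallness conditions make the contraction factor at most \<open>1/4 + 1/4\<close>, so the
  distance to \<open>a\<close> at least halves in each step and the iterates never leave the ball. The step estimate is assumed only
  inside the ball; that it applies to every iterate is part of the induction.\<close>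

lemma perturbed_quadratic_recursion:
  fixes x :: "nat \<Rightarrow> 'a::real_normed_vector"
  assumes step: "\<And>k. norm (x k - a) < \<rho> \<Longrightarrow>
        norm (x (Suc k) - a) \<le> (\<alpha> * \<eta> k + \<beta> * norm (x k - a)) * norm (x k - a)"
    and "\<alpha> \<ge> 0" "\<beta> \<ge> 0" and \<eta>: "\<And>k. \<eta> k \<le> b" and "\<alpha> * b \<le> 1 / 4" "\<beta> * \<rho> \<le> 1 / 4"
    and x0: "norm (x 0 - a) < \<rho>"
  shows "norm (x k - a) < \<rho>"
    and "norm (x (Suc k) - a) \<le> 1 / 2 * norm (x k - a)"
    and "x \<longlonglongrightarrow> a"
proof -
  have half: "norm (x (Suc k) - a) \<le> 1 / 2 * norm (x k - a)" if "norm (x k - a) < \<rho>" for k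
  proof -
    have "\<alpha> * \<eta> k \<le> \<alpha> * b" "\<beta> * norm (x k - a) \<le> \<beta> * \<rho>"
      using \<eta> that assms(2,3) by (auto intro!: mult_left_mono)
    then have "\<alpha> * \<eta> k + \<beta> * norm (x k - a) \<le> 1 / 2"
      using assms(5,6) by linarith
    then have "(\<alpha> * \<eta> k + \<beta> * norm (x k - a)) * norm (x k - a) \<le> 1 / 2 * norm (x k - a)"
      by (rule mult_right_mono) simp
    with step[OF that] show ?thesis by linarith
  qed
  have ball: "norm (x k - a) < \<rho>" for k
  proof (induction k)
    case (Suc k)
    then show ?case using half[OF Suc] norm_ge_zero[of "x k - a"] by linarith
  qed (rule x0)
  have geom: "norm (x k - a) \<le> norm (x 0 - a) * (1 / 2) ^ k" for k
  proof (induction k)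
    case (Suc k)
    then show ?case using half[OF ball, of k] by simp
  qed simp
  have "(\<lambda>k. norm (x 0 - a) * (1 / 2) ^ k) \<longlonglongrightarrow> norm (x 0 - a) * 0"
    by (intro tendsto_mult_left LIMSEQ_realpow_zero) auto
  then have "(\<lambda>k. norm (x 0 - a) * (1 / 2) ^ k) \<longlonglongrightarrow> 0" by simp
  then have "(\<lambda>k. x k - a) \<longlonglongrightarrow> 0"
    by (rule Lim_null_comparison[rotated]) (simp add: geom)
  then show "x \<longlonglongrightarrow> a" by (simp add: LIM_zero_iff)
  show "norm (x k - a) < \<rho>" by (rule ball)
  show "norm (x (Suc k) - a) \<le> 1 / 2 * norm (x k - a)" by (rule half[OF ball])
qed

section \<open>Local convergence\<close>

theorem theorem4p4:
  fixes f :: "real^'n \<Rightarrow> real"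
    and g :: "real^'n \<Rightarrow> real^'n"
    and H :: "real^'n \<Rightarrow> ((real^'n) \<Rightarrow>\<^sub>L (real^'n))"
    and \<mu> \<tau> :: real
    and xs :: "real^'n"
  assumes convex: "convex_on UNIV f"
    and gradient: "\<And>x. GDERIV f x :> g x"
    and hessian: "\<And>x. (g has_derivative blinfun_apply (H x)) (at x)"
    and hessian_cont: "continuous_on UNIV H"
    and mu: "\<mu> > 0"
    and tau: "\<tau> > 0"
    and minimizer: "is_arg_min (l1_objective f \<mu>) (\<lambda>_. True) xs"
    and hessian_lipschitz: "\<exists>L. L-lipschitz_on UNIV H"
    and hessian_pos: "pos_definite (H xs)"
    and tau_less: "\<tau> < 1 / norm (H xs)"
  shows "\<exists>N \<eta>bar. open N \<and> xs \<in> N \<and> \<eta>bar > 0 \<and>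
    (\<forall>(x :: nat \<Rightarrow> real^'n) (r :: nat \<Rightarrow> real^'n) (\<eta> :: nat \<Rightarrow> real).
      (\<forall>k. Fq_res g H \<mu> \<tau> (x k) (x (Suc k)) = r k \<and>
           norm (r k) \<le> \<eta> k * norm (F_res g \<mu> \<tau> (x k)) \<and> \<eta> k \<ge> 0) \<longrightarrow>
      (\<forall>k. \<eta> k \<le> \<eta>bar) \<longrightarrow>
      x 0 \<in> N \<longrightarrow>
        Q_linear x xs \<and>
        (\<eta> \<longlonglongrightarrow> 0 \<longrightarrow> Q_superlinear x xs) \<and>
        ((\<exists>\<eta>tilde. \<forall>k. \<eta> k \<le> \<eta>tilde * norm (F_res g \<mu> \<tau> (x k))) \<longrightarrow> Q_quadratic x xs))"
proof -
  have mu': "\<mu> \<ge> 0" using mu by simp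
  have root: "F_res g \<mu> \<tau> xs = 0"
    by (rule F_res_minimizer[where g = g, OF minimizer gradient mu' tau])
  obtain L where lip: "L-lipschitz_on UNIV H" using hessian_lipschitz by blast
  obtain \<rho>0 M \<alpha> \<beta> where pos: "\<rho>0 > 0" "M > 0" "\<alpha> > 0" "\<beta> \<ge> 0"
    and FM: "\<And>x. norm (x - xs) < \<rho>0 \<Longrightarrow> norm (F_res g \<mu> \<tau> x) \<le> M * norm (x - xs)"
    and step: "\<And>x y e. norm (x - xs) < \<rho>0 \<Longrightarrow> e \<ge> 0
           \<Longrightarrow> norm (Fq_res g H \<mu> \<tau> x y) \<le> e * norm (F_res g \<mu> \<tau> x)
           \<Longrightarrow> norm (y - xs) \<le> (\<alpha> * e + \<beta> * norm (x - xs)) * norm (x - xs)"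
    using inexact_Newton_step[OF hessian lip mu' tau root hessian_pos] by blast
  \<comment> \<open>the radius and the bound on the forcing terms each contribute a quarter to the contraction
    factor\<close>
  define \<rho> where "\<rho> = min \<rho>0 (1 / (4 * (\<beta> + 1)))"
  define b where "b = 1 / (4 * \<alpha>)"
  have "\<rho> > 0" "b > 0" using pos by (auto simp: \<rho>_def b_def)
  have "\<beta> * \<rho> \<le> \<beta> * (1 / (4 * (\<beta> + 1)))"
    using pos by (intro mult_left_mono) (auto simp: \<rho>_def)
  also have "\<dots> \<le> 1 / 4" using pos by (simp add: divide_simps)
  finally have \<rho>: "\<beta> * \<rho> \<le> 1 / 4" .
  have b: "\<alpha> * b \<le> 1 / 4" using pos by (simp add: b_def)
  have "Q_linear x xs \<and> (\<eta> \<longlonglongrightarrow> 0 \<longrightarrow> Q_superlinear x xs) \<and>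
        ((\<exists>\<eta>tilde. \<forall>k. \<eta> k \<le> \<eta>tilde * norm (F_res g \<mu> \<tau> (x k))) \<longrightarrow> Q_quadratic x xs)"
    if iter: "\<forall>k. Fq_res g H \<mu> \<tau> (x k) (x (Suc k)) = r k \<and>
           norm (r k) \<le> \<eta> k * norm (F_res g \<mu> \<tau> (x k)) \<and> \<eta> k \<ge> 0"
      and \<eta>b: "\<forall>k. \<eta> k \<le> b" and x0: "x 0 \<in> ball xs \<rho>"
    for x r :: "nat \<Rightarrow> real^'n" and \<eta> :: "nat \<Rightarrow> real"
  proof -
    have rec0: "norm (x (Suc k) - xs)
        \<le> (\<alpha> * \<eta> k + \<beta> * norm (x k - xs)) * norm (x k - xs)" if "norm (x k - xs) < \<rho>" for k
      using iter that by (intro step) (auto simp: \<rho>_def)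
    have x0': "norm (x 0 - xs) < \<rho>" using x0 by (simp add: dist_norm norm_minus_commute)
    note conv = perturbed_quadratic_recursion[OF rec0 less_imp_le[OF pos(3)] pos(4)
        \<eta>b[rule_format] b \<rho> x0']
    note rec = rec0[OF conv(1)]
    have "Q_linear x xs"
      unfolding Q_linear_def using conv(2,3) by (intro conjI exI[of _ "1 / 2"]) auto
    moreover have "Q_superlinear x xs" if \<eta>0: "\<eta> \<longlonglongrightarrow> 0"
    proof -
      have "(\<lambda>k. norm (x k - xs)) \<longlonglongrightarrow> 0"
        using conv(3) by (simp add: LIM_zero tendsto_norm_zero)
      then have "(\<lambda>k. \<alpha> * \<eta> k + \<beta> * norm (x k - xs)) \<longlonglongrightarrow> \<alpha> * 0 + \<beta> * 0"
        by (intro tendsto_add tendsto_mult_left \<eta>0)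
      then show ?thesis
        unfolding Q_superlinear_def using conv(3) rec
        by (intro conjI exI[of _ "\<lambda>k. \<alpha> * \<eta> k + \<beta> * norm (x k - xs)"]) auto
    qed
    moreover have "Q_quadratic x xs" if t: "\<forall>k. \<eta> k \<le> t * norm (F_res g \<mu> \<tau> (x k))" for t
    proof -
      have "norm (x (Suc k) - xs) \<le> (\<alpha> * (\<bar>t\<bar> * M) + \<beta>) * (norm (x k - xs))\<^sup>2" for k
      proof -
        have "\<eta> k \<le> t * norm (F_res g \<mu> \<tau> (x k))" using t by blast
        also have "\<dots> \<le> \<bar>t\<bar> * norm (F_res g \<mu> \<tau> (x k))"
          by (intro mult_right_mono) auto
        also have "\<dots> \<le> \<bar>t\<bar> * (M * norm (x k - xs))"
          using conv(1)[of k] by (intro mult_left_mono FM) (auto simp: \<rho>_def)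
        finally have "\<alpha> * \<eta> k \<le> \<alpha> * (\<bar>t\<bar> * (M * norm (x k - xs)))"
          using pos(3) by (intro mult_left_mono) auto
        then have "(\<alpha> * \<eta> k + \<beta> * norm (x k - xs)) * norm (x k - xs)
            \<le> (\<alpha> * (\<bar>t\<bar> * (M * norm (x k - xs))) + \<beta> * norm (x k - xs)) * norm (x k - xs)"
          by (intro mult_right_mono add_right_mono) auto
        with rec[of k] show ?thesis by (simp add: power2_eq_square algebra_simps)
      qed
      then show ?thesis
        unfolding Q_quadratic_def using conv(3)
        by (intro conjI exI[of _ "\<alpha> * (\<bar>t\<bar> * M) + \<beta>"]) auto
    qed
    ultimately show ?thesis by blast
  qed
  then show ?thesis
    using \<open>\<rho> > 0\<close> \<open>b > 0\<close>
    by (intro exI[of _ "ball xs \<rho>"] exI[of _ b] conjI allI impI open_ball centre_in_ball[THEN iffD2])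
       blast+
qed

end
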